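(* For all positive integers $n,m$: $$\int_{-\pi}^{\pi}\cos(nx)\cos(mx)\,dx=\begin{cases}0&n\ne m,\\ \pi&n=m,\end{cases}\qquad \int_{-\pi}^{\pi}\sin(nx)\sin(mx)\,dx=\begin{cases}0&n\ne m,\\ \pi&n=m,\end{cases}$$ and $$\int_{-\pi}^{\pi}\cos(nx)\sin(mx)\,dx=0.$$ *)

theory Defs
  imports "HOL-Analysis.Analysis"
begin

end

theory Submission
  imports Defs
begin

text \<open>The product-to-sum formulas turn each product of two frequencies \<open>n\<close> and \<open>m\<close> into half a sum or
  difference of single waves with integer frequencies \<open>n - m\<close> and \<open>n + m\<close>. Over the full period
  from \<open>- pi\<close> to \<open>pi\<close> a sine of integer frequency integrates to \<open>0\<close>, and so does a cosine, except that
  the cosine of frequency \<open>0\<close> is the constant \<open>1\<close> and integrates to \<open>2 * pi\<close>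
  (\<open>has_integral_sin_nx\<close> and \<open>has_integral_cos_nx\<close>). Since \<open>n\<close> and \<open>m\<close> are positive, the frequency
  \<open>n + m\<close> never vanishes; \<open>n - m\<close> vanishes exactly when \<open>n = m\<close>, and then half of \<open>2 * pi\<close> is left
  over for the two products of like functions. The mixed product only produces sines.\<close>

theorem lemma3p2:
  fixes n m :: nat
  assumes "n > 0" and "m > 0"
  shows "((\<lambda>x::real. cos (real n * x) * cos (real m * x)) has_integral (if n \<noteq> m then 0 else pi)) {-pi..pi}
       \<and> ((\<lambda>x::real. sin (real n * x) * sin (real m * x)) has_integral (if n \<noteq> m then 0 else pi)) {-pi..pi}
       \<and> ((\<lambda>x::real. cos (real n * x) * sin (real m * x)) has_integral 0) {-pi..pi}"
proof -
  \<comment> \<open>The difference is taken in the integers, since \<open>n < m\<close> is possible.\<close>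
  define d s where "d = int n - int m" and "s = int n + int m"
  have freq: "real n * x - real m * x = of_int d * x" "real n * x + real m * x = of_int s * x" for x
    by (simp_all add: d_def s_def algebra_simps)
  have "s \<noteq> 0" and d0: "d = 0 \<longleftrightarrow> n = m"
    using assms by (auto simp: d_def s_def)
  then have cos_s: "((\<lambda>x. cos (of_int s * x)) has_integral 0) {-pi..pi}"
    using has_integral_cos_nx[of s] by simp
  have cos_d: "((\<lambda>x. cos (of_int d * x)) has_integral (if n \<noteq> m then 0 else 2 * pi)) {-pi..pi}"
    using has_integral_cos_nx[of d] d0 by (simp split: if_splits)
  have "((\<lambda>x. cos (real n * x) * cos (real m * x)) has_integral (if n \<noteq> m then 0 else pi)) {-pi..pi}"
    using has_integral_divide[OF has_integral_add[OF cos_d cos_s], of 2]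
    by (simp add: cos_times_cos freq split: if_splits)
  moreover have "((\<lambda>x. sin (real n * x) * sin (real m * x)) has_integral (if n \<noteq> m then 0 else pi)) {-pi..pi}"
    using has_integral_divide[OF has_integral_diff[OF cos_d cos_s], of 2]
    by (simp add: sin_times_sin freq split: if_splits)
  moreover have "((\<lambda>x. cos (real n * x) * sin (real m * x)) has_integral 0) {-pi..pi}"
    using has_integral_divide[OF has_integral_diff[OF has_integral_sin_nx[of s] has_integral_sin_nx[of d]], of 2]
    by (simp add: cos_times_sin freq)
  ultimately show ?thesis by blast
qed

end
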